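(* Let $T$ be a set and for every $t\in T$ let $E_t$ be a second-countable, complete extended pseudo-metric space, equipped with the Borel $\sigma$-algebra $\mathcal F_t$ generated by its topology. Let $(P_J)_{J\subseteq T\text{ finite}}$ be a projective family of finite measures, $P_J$ being a measure on $(E_J,\mathcal F_J)$. Let $\mathcal A:=\{\pi_J^{-1}(A): J\subseteq T\text{ finite},\ A\in\mathcal F_J\}$ be the collection of cylinder sets in $E_T$, and let $P$ be the set function on $\mathcal A$ given by $P(\pi_J^{-1}(A))=P_J(A)$ for $J\subseteq T$ finite and $A\in\mathcal F_J$. Then there is a unique measure on $\sigma(\mathcal A)$ that extends $P$ (the projective limit of the family).
   Context: For $J\subseteq T$, $E_J:=\prod_{j\in J}E_j$; $\pi_J:E_T\to E_J$ is the projection, and for $H\subseteq J$, $\pi^J_H:E_J\to E_H$ is the projection. For finite $J$, $\mathcal F_J$ is the product $\sigma$-algebra of the $\mathcal F_j$, $j\in J$, on $E_J$. A family $(P_J)_{J\subseteq T\text{ finite}}$ of finite measures $P_J$ on $\mathcal F_J$ is projective if $P_H=(\pi_H^J)_*P_J$ (pushforward measure) for all finite $H\subseteq J\subseteq T$. An extended pseudo-metric is a symmetric function $d$ with values in $[0,+\infty]$ satisfying $d(x,x)=0$ and the triangle inequality; $d(x,y)=0$ with $x\ne y$ is allowed. *)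

theory Defs
  imports "HOL-Probability.Probability"
begin

section \<open>Extended pseudo-metric spaces\<close>

text \<open>
  An extended pseudo-metric space is a carrier \<open>E\<close> together with \<open>d\<close>, on which nothing is
  assumed outside \<open>E\<close>. The definitions parallel those of \<^locale>\<open>Metric_space\<close>.
\<close>

definition ext_pseudo_metric :: "'a set \<Rightarrow> ('a \<Rightarrow> 'a \<Rightarrow> ennreal) \<Rightarrow> bool" where
  "ext_pseudo_metric E d \<longleftrightarrow>
     (\<forall>x\<in>E. d x x = 0) \<and>
     (\<forall>x\<in>E. \<forall>y\<in>E. d x y = d y x) \<and>
     (\<forall>x\<in>E. \<forall>y\<in>E. \<forall>z\<in>E. d x z \<le> d x y + d y z)"

definition epm_ball :: "'a set \<Rightarrow> ('a \<Rightarrow> 'a \<Rightarrow> ennreal) \<Rightarrow> 'a \<Rightarrow> ennreal \<Rightarrow> 'a set" where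
  "epm_ball E d x r = {y \<in> E. d x y < r}"

definition epm_open :: "'a set \<Rightarrow> ('a \<Rightarrow> 'a \<Rightarrow> ennreal) \<Rightarrow> 'a set \<Rightarrow> bool" where
  "epm_open E d U \<longleftrightarrow> U \<subseteq> E \<and> (\<forall>x\<in>U. \<exists>r>0. epm_ball E d x r \<subseteq> U)"

lemma istopology_epm_open: "istopology (epm_open E d)"
  unfolding istopology_def
proof (intro conjI allI impI)
  fix S S' assume S: "epm_open E d S" and S': "epm_open E d S'"
  have "\<exists>r>0. epm_ball E d x r \<subseteq> S \<inter> S'" if x: "x \<in> S" "x \<in> S'" for x
  proof -
    obtain r where r: "r > 0" "epm_ball E d x r \<subseteq> S"
      using S x(1) unfolding epm_open_def by blast
    obtain r' where r': "r' > 0" "epm_ball E d x r' \<subseteq> S'"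
      using S' x(2) unfolding epm_open_def by blast
    have "min r r' > 0"
      using r(1) r'(1) by simp
    moreover have "epm_ball E d x (min r r') \<subseteq> S \<inter> S'"
      using r(2) r'(2) by (auto simp: epm_ball_def)
    ultimately show ?thesis
      by (intro exI conjI)
  qed
  moreover have "S \<inter> S' \<subseteq> E"
    using S by (auto simp: epm_open_def)
  ultimately show "epm_open E d (S \<inter> S')"
    by (simp add: epm_open_def)
next
  fix \<K> assume \<K>: "\<forall>K\<in>\<K>. epm_open E d K"
  have "\<exists>r>0. epm_ball E d x r \<subseteq> \<Union>\<K>" if K: "K \<in> \<K>" "x \<in> K" for K x
  proof -
    have "epm_open E d K"
      using \<K> K(1) by (rule bspec)
    then obtain r where r: "r > 0" "epm_ball E d x r \<subseteq> K"
      using K(2) unfolding epm_open_def by blast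
    have "epm_ball E d x r \<subseteq> \<Union>\<K>"
      using r(2) Union_upper[OF K(1)] by (rule subset_trans)
    with r(1) show ?thesis
      by (intro exI conjI)
  qed
  moreover have "\<Union>\<K> \<subseteq> E"
    using \<K> by (intro Union_least) (simp add: epm_open_def)
  ultimately show "epm_open E d (\<Union>\<K>)"
    by (simp add: epm_open_def)
qed

definition epm_topology :: "'a set \<Rightarrow> ('a \<Rightarrow> 'a \<Rightarrow> ennreal) \<Rightarrow> 'a topology" where
  "epm_topology E d = topology (epm_open E d)"

lemma openin_epm_topology:
  "openin (epm_topology E d) U \<longleftrightarrow> U \<subseteq> E \<and> (\<forall>x\<in>U. \<exists>r>0. epm_ball E d x r \<subseteq> U)"
  unfolding epm_topology_def topology_inverse'[OF istopology_epm_open] by (rule epm_open_def)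

lemma topspace_epm_topology [simp]: "topspace (epm_topology E d) = E"
proof (rule equalityI)
  show "topspace (epm_topology E d) \<subseteq> E"
    using openin_topspace[of "epm_topology E d"] by (simp only: openin_epm_topology)
  have "epm_ball E d x 1 \<subseteq> E" for x
    by (auto simp: epm_ball_def)
  then have "openin (epm_topology E d) E"
    unfolding openin_epm_topology by (intro conjI ballI exI[of _ 1] subset_refl zero_less_one)
  then show "E \<subseteq> topspace (epm_topology E d)"
    by (rule openin_subset)
qed

definition epm_Cauchy :: "'a set \<Rightarrow> ('a \<Rightarrow> 'a \<Rightarrow> ennreal) \<Rightarrow> (nat \<Rightarrow> 'a) \<Rightarrow> bool" where
  "epm_Cauchy E d \<sigma> \<longleftrightarrow>
     range \<sigma> \<subseteq> E \<and> (\<forall>\<epsilon>>0. \<exists>N. \<forall>m\<ge>N. \<forall>n\<ge>N. d (\<sigma> m) (\<sigma> n) < \<epsilon>)"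

definition epm_complete :: "'a set \<Rightarrow> ('a \<Rightarrow> 'a \<Rightarrow> ennreal) \<Rightarrow> bool" where
  "epm_complete E d \<longleftrightarrow>
     (\<forall>\<sigma>. epm_Cauchy E d \<sigma> \<longrightarrow> (\<exists>x. limitin (epm_topology E d) \<sigma> x sequentially))"

definition epm_borel :: "'a set \<Rightarrow> ('a \<Rightarrow> 'a \<Rightarrow> ennreal) \<Rightarrow> 'a measure" where
  "epm_borel E d = sigma E {U. openin (epm_topology E d) U}"

lemma open_sets_subset: "{U. openin (epm_topology E d) U} \<subseteq> Pow E"
  by (auto simp: openin_epm_topology)

lemma space_epm_borel [simp]: "space (epm_borel E d) = E"
  unfolding epm_borel_def by (rule space_measure_of[OF open_sets_subset])

lemma sets_epm_borel: "sets (epm_borel E d) = sigma_sets E {U. openin (epm_topology E d) U}"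
  unfolding epm_borel_def by (rule sets_measure_of[OF open_sets_subset])

section \<open>Projective families of finite measures\<close>

text \<open>
  Below, \<open>M t\<close> only serves to carry the measurable space \<open>(E\<^sub>t, \<F>\<^sub>t)\<close>, so that
  \<open>(E\<^sub>J, \<F>\<^sub>J)\<close> is the measurable space of \<open>PiM J M\<close>, and \<open>\<pi>\<^sub>J\<inverse>(A)\<close> is \<open>prod_emb T M J A\<close>.
  The library's locale \<^locale>\<open>projective_family\<close> is not used because it demands
  probability measures.
\<close>

definition projective_finite_measures ::
    "'i set \<Rightarrow> ('i \<Rightarrow> 'a measure) \<Rightarrow> ('i set \<Rightarrow> ('i \<Rightarrow> 'a) measure) \<Rightarrow> bool" where
  "projective_finite_measures T M P \<longleftrightarrow>
     (\<forall>J. finite J \<and> J \<subseteq> T \<longrightarrow> sets (P J) = sets (PiM J M) \<and> finite_measure (P J)) \<and>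
     (\<forall>J H. finite J \<and> J \<subseteq> T \<and> H \<subseteq> J \<longrightarrow> P H = distr (P J) (PiM H M) (\<lambda>x. restrict x H))"

definition cylinder_sets :: "'i set \<Rightarrow> ('i \<Rightarrow> 'a measure) \<Rightarrow> ('i \<Rightarrow> 'a) set set" where
  "cylinder_sets T M = {prod_emb T M J A | J A. finite J \<and> J \<subseteq> T \<and> A \<in> sets (PiM J M)}"

text \<open>
  A cylinder set may have several representations \<open>\<pi>\<^sub>J\<inverse>(A)\<close>; that the value below does not
  depend on the representation is something to be proved.
\<close>

definition cylinder_function ::
    "'i set \<Rightarrow> ('i \<Rightarrow> 'a measure) \<Rightarrow> ('i set \<Rightarrow> ('i \<Rightarrow> 'a) measure) \<Rightarrow> ('i \<Rightarrow> 'a) set \<Rightarrow> ennreal" where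
  "cylinder_function T M P C =
     (THE c. \<exists>J A. finite J \<and> J \<subseteq> T \<and> A \<in> sets (PiM J M) \<and>
                   C = prod_emb T M J A \<and> c = emeasure (P J) A)"

end

theory Submission
  imports Defs
begin

text \<open>
  Fix a dense sequence \<open>u\<close> in \<open>E\<^sub>t\<close> and let \<open>\<rho> = min 1 d\<close>. The map \<open>g x = (\<lambda>n. \<rho> x (u n))\<close> into
  \<open>\<nat> \<Rightarrow> \<real>\<close> generates the Borel \<open>\<sigma>\<close>-algebra of \<open>E\<^sub>t\<close>, and by completeness its image consists of
  exactly those \<open>y\<close> with \<open>\<bar>y n - y m\<bar> \<le> \<rho> (u m) (u n) \<le> y n + y m\<close> and infimum \<open>0\<close>, which
  is a Borel set. So \<open>g\<close> has a measurable right inverse \<open>h\<close> on its image, and \<open>h \<circ> g\<close> preserves every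
  measurable set. This transports the family, normalised, to the Polish space \<open>\<nat> \<Rightarrow> \<real>\<close>, where the
  Daniell-Kolmogorov theorem applies, and transports the limit back.
\<close>

section \<open>Coding extended pseudo-metric spaces by real sequences\<close>

text \<open>In the Borel space of a pseudo-metric, points at distance 0 lie in the same measurable
  sets, so a measurable \<open>g\<close> cannot separate them and \<open>h\<close> cannot recover
  the point. Preserving membership in measurable sets is what the transport of measures
  needs.\<close>

definition borel_coding :: "'a measure \<Rightarrow> ('a \<Rightarrow> nat \<Rightarrow> real) \<Rightarrow> ((nat \<Rightarrow> real) \<Rightarrow> 'a) \<Rightarrow> bool" where
  "borel_coding M g h \<longleftrightarrow> g \<in> borel_measurable M \<and> h \<in> borel \<rightarrow>\<^sub>M M \<and>
     (\<forall>A\<in>sets M. \<forall>x\<in>space M. h (g x) \<in> A \<longleftrightarrow> x \<in> A)"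

section \<open>From extended distances to real numbers\<close>

lemma ennreal_pos_real_le_one:
  assumes "0 < \<epsilon>"
  obtains e where "0 < e" "e \<le> 1" "ennreal e \<le> \<epsilon>"
proof (cases \<epsilon>)
  case (real r)
  then show ?thesis
    using assms by (intro that[of "min r 1"]) (auto simp: ennreal_leI)
qed (auto intro: that[of 1])

text \<open>Truncation at 1 makes the distance real-valued and leaves all balls of radius at most 1
  unchanged, hence also the topology and the Cauchy sequences.\<close>

definition trunc_dist :: "('a \<Rightarrow> 'a \<Rightarrow> ennreal) \<Rightarrow> 'a \<Rightarrow> 'a \<Rightarrow> real" where
  "trunc_dist d x y = enn2real (min 1 (d x y))"

lemma ennreal_trunc_dist: "ennreal (trunc_dist d x y) = min 1 (d x y)"
  unfolding trunc_dist_def by (intro ennreal_enn2real) (simp add: min_less_iff_disj)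

lemma trunc_dist_nonneg [simp]: "0 \<le> trunc_dist d x y"
  by (simp add: trunc_dist_def)

lemma trunc_dist_less_iff:
  assumes "0 < r" "r \<le> 1"
  shows "trunc_dist d x y < r \<longleftrightarrow> d x y < ennreal r"
proof -
  have "trunc_dist d x y < r \<longleftrightarrow> min 1 (d x y) < ennreal r"
    using assms by (simp add: ennreal_less_iff flip: ennreal_trunc_dist)
  also have "\<dots> \<longleftrightarrow> d x y < ennreal r"
    using assms by (auto simp: min_less_iff_disj dest: ennreal_less_one_iff[THEN iffD1])
  finally show ?thesis .
qed

section \<open>Metric and Borel structure of a single space\<close>

context
  fixes E :: "'a set" and d :: "'a \<Rightarrow> 'a \<Rightarrow> ennreal"
  assumes epm: "ext_pseudo_metric E d"
begin

lemma epm_self: "x \<in> E \<Longrightarrow> d x x = 0"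
  and epm_sym: "x \<in> E \<Longrightarrow> y \<in> E \<Longrightarrow> d x y = d y x"
  and epm_triangle: "x \<in> E \<Longrightarrow> y \<in> E \<Longrightarrow> z \<in> E \<Longrightarrow> d x z \<le> d x y + d y z"
  using epm by (auto simp: ext_pseudo_metric_def)

lemma trunc_dist_sym: "x \<in> E \<Longrightarrow> y \<in> E \<Longrightarrow> trunc_dist d x y = trunc_dist d y x"
  by (simp add: trunc_dist_def epm_sym)

lemma trunc_dist_triangle:
  assumes "x \<in> E" "y \<in> E" "z \<in> E"
  shows "trunc_dist d x z \<le> trunc_dist d x y + trunc_dist d y z"
proof -
  have "min 1 (d x z) \<le> min 1 (d x y) + min 1 (d y z)"
  proof (cases "d x y \<le> 1 \<and> d y z \<le> 1")
    case True
    then show ?thesis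
      using epm_triangle[OF assms] by (simp add: min_absorb2 min.coboundedI2)
  next
    case False
    then have "1 \<le> min 1 (d x y) + min 1 (d y z)"
      by (auto simp: min_def intro: add_increasing add_increasing2)
    then show ?thesis
      by (meson min.cobounded1 order_trans)
  qed
  then have "ennreal (trunc_dist d x z) \<le> ennreal (trunc_dist d x y + trunc_dist d y z)"
    by (simp add: ennreal_trunc_dist)
  then show ?thesis
    by (simp del: ennreal_plus)
qed

lemma openin_epm_ball:
  assumes "x \<in> E"
  shows "openin (epm_topology E d) (epm_ball E d x r)"
  unfolding openin_epm_topology
proof (intro conjI ballI)
  fix y assume y: "y \<in> epm_ball E d x r"
  then have yE: "y \<in> E" and yr: "d x y < r"
    by (auto simp: epm_ball_def)
  have "d x z < r" if "z \<in> E" "d y z < r - d x y" for z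
  proof -
    have "d x z \<le> d x y + d y z"
      using assms yE that by (intro epm_triangle)
    also have "\<dots> < r"
      using that(2) yr by (metis add.commute less_diff_eq_ennreal less_top order_less_imp_not_less top.not_eq_extremum)
    finally show ?thesis .
  qed
  then have "epm_ball E d y (r - d x y) \<subseteq> epm_ball E d x r"
    by (auto simp: epm_ball_def)
  moreover have "r - d x y > 0"
    using yr by (simp add: diff_gr0_ennreal)
  ultimately show "\<exists>s>0. epm_ball E d y s \<subseteq> epm_ball E d x r"
    by blast
qed (auto simp: epm_ball_def)

lemma measurable_trunc_dist:
  assumes "y \<in> E"
  shows "(\<lambda>x. trunc_dist d x y) \<in> borel_measurable (epm_borel E d)"
proof -
  have "(\<lambda>x. d x y) \<in> borel_measurable (epm_borel E d)"
  proof (rule borel_measurableI_less)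
    fix r
    have "{x \<in> space (epm_borel E d). d x y < r} = epm_ball E d y r"
      using assms epm_sym by (auto simp: epm_ball_def)
    also have "\<dots> \<in> sets (epm_borel E d)"
      using openin_epm_ball[OF assms] by (auto simp: sets_epm_borel)
    finally show "{x \<in> space (epm_borel E d). d x y < r} \<in> sets (epm_borel E d)" .
  qed
  then show ?thesis
    unfolding trunc_dist_def by measurable
qed

text \<open>One point is chosen from each nonempty member of a countable base; a base set around
  \<open>x\<close> inside a small ball contributes a point close to \<open>x\<close>.\<close>

lemma second_countable_dense_sequence:
  assumes "second_countable (epm_topology E d)" "E \<noteq> {}"
  obtains u :: "nat \<Rightarrow> 'a" where "range u \<subseteq> E"
    "\<And>x r. x \<in> E \<Longrightarrow> 0 < r \<Longrightarrow> \<exists>n. trunc_dist d x (u n) < r"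
proof -
  obtain B where B: "countable B" "\<And>V. V \<in> B \<Longrightarrow> openin (epm_topology E d) V"
    "\<And>U x. openin (epm_topology E d) U \<Longrightarrow> x \<in> U \<Longrightarrow> \<exists>V\<in>B. x \<in> V \<and> V \<subseteq> U"
    using assms(1) unfolding second_countable_def by metis
  define D where "D = (\<lambda>V. SOME x. x \<in> V) ` (B - {{}})"
  have D: "(SOME x. x \<in> V) \<in> D \<and> (SOME x. x \<in> V) \<in> V" if "V \<in> B" "x \<in> V" for V x
    using that by (auto simp: D_def intro: someI)
  have ball: "\<exists>y\<in>D. trunc_dist d x y < r" if x: "x \<in> E" and r: "0 < r" for x and r :: real
  proof -
    have "x \<in> epm_ball E d x (ennreal (min r 1))"
      using x r by (simp add: epm_ball_def epm_self)
    then obtain V where V: "V \<in> B" "x \<in> V" "V \<subseteq> epm_ball E d x (ennreal (min r 1))"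
      using B(3)[OF openin_epm_ball[OF x]] by blast
    define y where "y = (SOME x. x \<in> V)"
    have y: "y \<in> D" "y \<in> V"
      using D[OF V(1,2)] by (auto simp: y_def)
    with V(3) have "d x y < ennreal (min r 1)"
      by (auto simp: epm_ball_def)
    then have "trunc_dist d x y < min r 1"
      using r by (subst trunc_dist_less_iff) auto
    with y(1) show ?thesis
      by auto
  qed
  \<comment> \<open>Only for a nonempty set does \<open>from_nat_into\<close> have exactly that set
    as its range.\<close>
  have "D \<noteq> {}"
    using assms(2) ball[OF _ zero_less_one] by blast
  moreover have "countable D"
    using B(1) by (simp add: D_def)
  ultimately have rng: "range (from_nat_into D) = D"
    by (rule range_from_nat_into)
  have "D \<subseteq> E"
  proof
    fix y assume "y \<in> D"
    then obtain V where V: "V \<in> B" "V \<noteq> {}" "y = (SOME x. x \<in> V)"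
      by (auto simp: D_def)
    then have "y \<in> V"
      by (simp add: some_in_eq)
    then show "y \<in> E"
      using B(2)[OF V(1)] by (auto simp: openin_epm_topology)
  qed
  show thesis
  proof (rule that[of "from_nat_into D"])
    show "range (from_nat_into D) \<subseteq> E"
      using rng \<open>D \<subseteq> E\<close> by simp
    show "\<exists>n. trunc_dist d x (from_nat_into D n) < r" if "x \<in> E" "0 < r" for x r
      using ball[OF that] rng by (metis imageE)
  qed
qed

text \<open>The numbers \<open>y n\<close> behave like the distances of the \<open>u n\<close> to one ideal point, which is the limit
  of those \<open>u n\<close> with \<open>y n\<close> small.\<close>

lemma katetov_sequence_realised:
  assumes complete: "epm_complete E d"
    and u: "\<And>n. u n \<in> E"
    and y: "\<And>m n. \<bar>y n - y m\<bar> \<le> trunc_dist d (u m) (u n)"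
      "\<And>m n. trunc_dist d (u m) (u n) \<le> y n + y m"
    and inf: "\<And>k::nat. \<exists>n. y n < 1 / real (Suc k)"
  shows "\<exists>x\<in>E. \<forall>n. trunc_dist d x (u n) = y n"
proof -
  obtain s where s: "\<And>k. y (s k) < 1 / real (Suc k)"
    using inf by metis
  have small: "\<exists>N. \<forall>k\<ge>N. y (s k) < e" if "0 < e" for e
  proof -
    obtain N where N: "1 / real (Suc N) < e"
      using \<open>0 < e\<close> by (rule nat_approx_posE)
    have "y (s k) < e" if "k \<ge> N" for k
    proof -
      have "1 / real (Suc k) \<le> 1 / real (Suc N)"
        using that by (simp add: frac_le)
      with s[of k] N show ?thesis by linarith
    qed
    then show ?thesis by blast
  qed
  have "epm_Cauchy E d (\<lambda>k. u (s k))"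
    unfolding epm_Cauchy_def
  proof (intro conjI allI impI)
    fix \<epsilon> :: ennreal assume "0 < \<epsilon>"
    then obtain e where e: "0 < e" "e \<le> 1" "ennreal e \<le> \<epsilon>"
      by (rule ennreal_pos_real_le_one)
    obtain N where N: "\<And>k. k \<ge> N \<Longrightarrow> y (s k) < e / 2"
      using small[of "e / 2"] e by auto
    have "d (u (s m)) (u (s n)) < \<epsilon>" if "m \<ge> N" "n \<ge> N" for m n
    proof -
      \<comment> \<open>The upper bound \<open>y n + y m\<close> makes two points of the sequence
        close as soon as both values of \<open>y\<close> are small.\<close>
      have "trunc_dist d (u (s m)) (u (s n)) < e"
        using y(2)[of "s m" "s n"] N[OF that(1)] N[OF that(2)] by linarith
      then show ?thesis
        using e by (simp add: trunc_dist_less_iff)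
    qed
    then show "\<exists>N. \<forall>m\<ge>N. \<forall>n\<ge>N. d (u (s m)) (u (s n)) < \<epsilon>"
      by blast
  qed (use u in auto)
  then obtain x where x: "limitin (epm_topology E d) (\<lambda>k. u (s k)) x sequentially"
    using complete unfolding epm_complete_def by blast
  then have xE: "x \<in> E"
    using limitin_topspace by fastforce
  \<comment> \<open>The cap \<open>min e 1\<close> keeps the radius in the range where
    \<open>trunc_dist\<close> and \<open>d\<close> define the same ball.\<close>
  have close: "\<exists>k. y (s k) < e \<and> trunc_dist d x (u (s k)) < e" if "0 < e" for e
  proof -
    have "x \<in> epm_ball E d x (ennreal (min e 1))"
      using xE \<open>0 < e\<close> by (simp add: epm_ball_def epm_self)
    then have "\<forall>\<^sub>F k in sequentially. u (s k) \<in> epm_ball E d x (ennreal (min e 1))"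
      using limitinD[OF x openin_epm_ball[OF xE]] by blast
    moreover have "\<forall>\<^sub>F k in sequentially. y (s k) < e"
      using small[OF \<open>0 < e\<close>] by (simp add: eventually_sequentially)
    ultimately have "\<forall>\<^sub>F k in sequentially. y (s k) < e \<and> d x (u (s k)) < ennreal (min e 1)"
      by eventually_elim (auto simp: epm_ball_def)
    then obtain k where "y (s k) < e" "d x (u (s k)) < ennreal (min e 1)"
      using eventually_happens'[OF sequentially_bot] by blast
    moreover from this(2) have "trunc_dist d x (u (s k)) < min e 1"
      using \<open>0 < e\<close> by (subst trunc_dist_less_iff) auto
    ultimately show ?thesis by auto
  qed
  \<comment> \<open>Both numbers lie within \<open>e / 2\<close> of
    \<open>trunc_dist d (u (s k)) (u n)\<close>: \<open>y n\<close> by the two hypotheses on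
    \<open>y\<close>, the other by the triangle inequality.\<close>
  have "\<bar>trunc_dist d x (u n) - y n\<bar> \<le> 0" for n
  proof (rule field_le_epsilon)
    fix e :: real assume "0 < e"
    then obtain k where k: "y (s k) < e / 2" "trunc_dist d x (u (s k)) < e / 2"
      using close[of "e / 2"] by auto
    have "trunc_dist d x (u n) \<le> trunc_dist d x (u (s k)) + trunc_dist d (u (s k)) (u n)"
      "trunc_dist d (u (s k)) (u n) \<le> trunc_dist d (u (s k)) x + trunc_dist d x (u n)"
      using xE u by (auto intro: trunc_dist_triangle)
    moreover have "trunc_dist d (u (s k)) x = trunc_dist d x (u (s k))"
      using xE u by (rule trunc_dist_sym[rotated])
    ultimately show "\<bar>trunc_dist d x (u n) - y n\<bar> \<le> 0 + e"
      using k y(1)[of n "s k"] y(2)[of "s k" n] by linarith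
  qed
  with xE show ?thesis
    by (intro bexI[of _ x]) auto
qed

section \<open>Borel coding of one nonempty space\<close>

theorem ex_borel_coding:
  assumes "second_countable (epm_topology E d)" "epm_complete E d" "E \<noteq> {}"
  shows "\<exists>g h. borel_coding (epm_borel E d) g h"
proof -
  obtain u :: "nat \<Rightarrow> 'a" where "range u \<subseteq> E"
    and dense: "\<And>x r. x \<in> E \<Longrightarrow> 0 < r \<Longrightarrow> \<exists>n. trunc_dist d x (u n) < r"
    using second_countable_dense_sequence[OF assms(1,3)] by blast
  then have u: "\<And>n. u n \<in> E" by auto
  define g where "g x = (\<lambda>n. trunc_dist d x (u n))" for x
  \<comment> \<open>Taking \<open>m = n\<close> in the second inequality gives
    \<open>0 \<le> y n\<close>, so the last condition says that the infimum is 0. Countably many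
    conditions on coordinates make \<open>B\<close> Borel.\<close>
  define B where "B = {y :: nat \<Rightarrow> real.
    (\<forall>m n. \<bar>y n - y m\<bar> \<le> trunc_dist d (u m) (u n) \<and> trunc_dist d (u m) (u n) \<le> y n + y m) \<and>
    (\<forall>k::nat. \<exists>n. y n < 1 / real (Suc k))}"
  obtain x0 where x0: "x0 \<in> E"
    using assms(3) by blast
  \<comment> \<open>The default \<open>x0\<close> keeps \<open>h\<close> inside \<open>E\<close>;
    being constant off \<open>B\<close>, it does no harm to measurability.\<close>
  define h where "h y = (if y \<in> B then inv_into E g y else x0)" for y

  have image: "g ` E = B"
  proof (intro equalityI subsetI)
    fix y assume "y \<in> g ` E"
    then obtain x where x: "x \<in> E" "y = g x" by blast
    have "\<bar>g x n - g x m\<bar> \<le> trunc_dist d (u m) (u n)" "trunc_dist d (u m) (u n) \<le> g x n + g x m" for m n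
      using trunc_dist_triangle[OF x(1) u u, of m n] trunc_dist_triangle[OF x(1) u u, of n m]
        trunc_dist_triangle[OF u x(1) u, of m n] trunc_dist_sym[OF x(1) u, of m]
        trunc_dist_sym[OF u u, of m n]
      by (auto simp: g_def)
    then show "y \<in> B"
      using dense[OF x(1)] by (simp add: B_def x(2)) (simp add: g_def)
  next
    fix y assume "y \<in> B"
    then obtain x where "x \<in> E" "\<forall>n. trunc_dist d x (u n) = y n"
      using katetov_sequence_realised[of u y, OF assms(2) u] by (auto simp: B_def)
    then show "y \<in> g ` E"
      by (intro image_eqI[of _ _ x]) (auto simp: g_def)
  qed
  have g: "g \<in> borel_measurable (epm_borel E d)"
    unfolding g_def by (intro measurable_coordinatewise_then_product measurable_trunc_dist u)

  \<comment> \<open>This says that \<open>g\<close> generates the Borel sets. Preimages under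
    \<open>g\<close> form a \<sigma>-algebra, so open sets suffice, and an open set is the union of
    the countably many \<open>G n k\<close> that it contains.\<close>
  have saturated: "\<exists>A'\<in>sets borel. A = g -` A' \<inter> E" if "A \<in> sets (epm_borel E d)" for A
  proof -
    let ?V = "vimage_algebra E g borel"
    have "U \<in> sets ?V" if U: "openin (epm_topology E d) U" for U
    proof -
      define G where "G n k = {x \<in> E. g x n < 1 / real (Suc k)}" for n k
      have G: "G n k \<in> sets ?V" for n k
      proof -
        have [measurable]: "(\<lambda>y :: nat \<Rightarrow> real. y n) \<in> borel_measurable borel" for n
          by simp
        have [measurable]: "g \<in> borel_measurable ?V"
          by (rule measurable_vimage_algebra1) simp
        have "{x \<in> space ?V. g x n < 1 / real (Suc k)} \<in> sets ?V"
          by measurable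
        then show ?thesis
          by (simp add: G_def)
      qed
      have "U = (\<Union>p\<in>{p. G (fst p) (snd p) \<subseteq> U}. G (fst p) (snd p))"
      proof (intro equalityI subsetI)
        fix x assume x: "x \<in> U"
        then have xE: "x \<in> E"
          using U by (auto simp: openin_epm_topology)
        obtain r where r: "r > 0" "epm_ball E d x r \<subseteq> U"
          using U x by (auto simp: openin_epm_topology)
        obtain e where e: "0 < e" "e \<le> 1" "ennreal e \<le> r"
          using r(1) by (rule ennreal_pos_real_le_one)
        \<comment> \<open>Any two points of \<open>G n k\<close> are at truncated distance below
          \<open>2 / (k + 1)\<close>, hence the bound \<open>e / 2\<close>.\<close>
        obtain k where k: "1 / real (Suc k) < e / 2"
          using nat_approx_posE[of "e / 2"] e by auto
        obtain n where n: "trunc_dist d x (u n) < 1 / real (Suc k)"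
          using dense[OF xE, of "1 / real (Suc k)"] by auto
        have "G n k \<subseteq> U"
        proof
          fix z assume "z \<in> G n k"
          then have z: "z \<in> E" "trunc_dist d z (u n) < 1 / real (Suc k)"
            by (auto simp: G_def g_def)
          have "trunc_dist d x z < e"
            using trunc_dist_triangle[OF xE u z(1), of n] trunc_dist_sym[OF z(1) u, of n] z(2) n k
            by linarith
          then have "z \<in> epm_ball E d x r"
            using e z by (simp add: trunc_dist_less_iff epm_ball_def)
          with r show "z \<in> U" by blast
        qed
        moreover have "x \<in> G n k"
          using n xE by (simp add: G_def g_def)
        ultimately show "x \<in> (\<Union>p\<in>{p. G (fst p) (snd p) \<subseteq> U}. G (fst p) (snd p))"
          by (intro UN_I[of "(n, k)"]) auto
      qed auto
      also have "\<dots> \<in> sets ?V"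
        using G by (intro sets.countable_UN'') auto
      finally show ?thesis .
    qed
    then have "sigma_sets E {U. openin (epm_topology E d) U} \<subseteq> sets ?V"
      using sets.sigma_sets_subset[of "{U. openin (epm_topology E d) U}" ?V] by auto
    then have "A \<in> sets ?V"
      using that by (auto simp: sets_epm_borel)
    then show ?thesis
      by (subst (asm) sets_vimage_algebra2) auto
  qed

  have [measurable]: "(\<lambda>y :: nat \<Rightarrow> real. y n) \<in> borel_measurable borel" for n
    by simp
  have B_sets: "B \<in> sets borel"
    unfolding B_def by measurable
  have hE: "h y \<in> E" for y
    using x0 image by (auto simp: h_def intro: inv_into_into)
  have gh: "g (h y) = y" if "y \<in> B" for y
    using that image by (auto simp: h_def intro: f_inv_into_f)
  have "h \<in> borel \<rightarrow>\<^sub>M epm_borel E d"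
  proof (rule measurableI)
    fix A assume "A \<in> sets (epm_borel E d)"
    then obtain A' where A': "A' \<in> sets borel" "A = g -` A' \<inter> E"
      using saturated by blast
    \<comment> \<open>On \<open>B\<close>, membership of \<open>h y\<close> in \<open>A\<close> is
      decided by \<open>g (h y) = y\<close>.\<close>
    have "h y \<in> A \<longleftrightarrow> (if y \<in> B then y \<in> A' else x0 \<in> A)" for y
    proof (cases "y \<in> B")
      case True
      then show ?thesis
        using hE[of y] gh[of y] by (simp add: A'(2))
    qed (simp add: h_def)
    then have "h -` A \<inter> space borel = (B \<inter> A') \<union> (if x0 \<in> A then - B else {})"
      by (auto split: if_splits)
    also have "\<dots> \<in> sets borel"
      using B_sets A'(1) by auto
    finally show "h -` A \<inter> space borel \<in> sets borel" .
  qed (simp add: hE)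
  \<comment> \<open>The point \<open>h (g x)\<close> may differ from \<open>x\<close>, but both have
    the same image under \<open>g\<close>, and \<open>A\<close> is a preimage under
    \<open>g\<close>.\<close>
  moreover have "h (g x) \<in> A \<longleftrightarrow> x \<in> A" if "A \<in> sets (epm_borel E d)" "x \<in> E" for A x
  proof -
    obtain A' where "A = g -` A' \<inter> E"
      using saturated \<open>A \<in> sets _\<close> by blast
    moreover have "g x \<in> B"
      using image that(2) by blast
    ultimately show ?thesis
      using gh hE that(2) by auto
  qed
  ultimately show ?thesis
    using g by (auto simp: borel_coding_def)
qed

end


section \<open>Cylinder sets\<close>

lemma cylinder_sets_subset: "cylinder_sets T M \<subseteq> Pow (space (PiM T M))"
  by (auto simp: cylinder_sets_def prod_emb_def space_PiM)

text \<open>Boxes over finitely many coordinates generate the product \<sigma>-algebra and are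
  cylinder sets; conversely, cylinder sets are measurable.\<close>

lemma sets_PiM_cylinder_sets:
  "sets (PiM T M) = sigma_sets (space (PiM T M)) (cylinder_sets T M)"
proof (intro equalityI)
  have "prod_algebra T M \<subseteq> cylinder_sets T M"
  proof
    fix C assume "C \<in> prod_algebra T M"
    then obtain J X where "C = prod_emb T M J (Pi\<^sub>E J X)" "finite J" "J \<subseteq> T" "\<And>i. i \<in> J \<Longrightarrow> X i \<in> sets (M i)"
      by (rule prod_algebraE) blast
    moreover from this have "Pi\<^sub>E J X \<in> sets (PiM J M)"
      by (intro sets_PiM_I_finite) auto
    ultimately show "C \<in> cylinder_sets T M"
      unfolding cylinder_sets_def by blast
  qed
  then show "sets (PiM T M) \<subseteq> sigma_sets (space (PiM T M)) (cylinder_sets T M)"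
    unfolding sets_PiM space_PiM by (rule sigma_sets_mono')
next
  show "sigma_sets (space (PiM T M)) (cylinder_sets T M) \<subseteq> sets (PiM T M)"
    by (rule sets.sigma_sets_subset) (auto simp: cylinder_sets_def)
qed

lemma Int_stable_cylinder_sets: "Int_stable (cylinder_sets T M)"
proof (rule Int_stableI)
  fix C D assume "C \<in> cylinder_sets T M" "D \<in> cylinder_sets T M"
  then obtain J A K B where J: "finite J" "J \<subseteq> T" "A \<in> sets (PiM J M)" "C = prod_emb T M J A"
    and K: "finite K" "K \<subseteq> T" "B \<in> sets (PiM K M)" "D = prod_emb T M K B"
    by (auto simp: cylinder_sets_def)
  \<comment> \<open>Both cylinders are lifted to the common finite base \<open>J \<union> K\<close>
    and intersected there.\<close>
  have "C \<inter> D = prod_emb T M (J \<union> K) (prod_emb (J \<union> K) M J A \<inter> prod_emb (J \<union> K) M K B)"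
    using J K by (simp add: prod_emb_Int)
  moreover have "prod_emb (J \<union> K) M J A \<inter> prod_emb (J \<union> K) M K B \<in> sets (PiM (J \<union> K) M)"
    using J K by auto
  ultimately show "C \<inter> D \<in> cylinder_sets T M"
    using J K unfolding cylinder_sets_def by blast
qed

lemma space_PiM_in_cylinder_sets: "space (PiM T M) \<in> cylinder_sets T M"
proof -
  have "space (PiM T M) = prod_emb T M {} (space (PiM {} M))"
    by (auto simp: prod_emb_def space_PiM)
  then show ?thesis
    unfolding cylinder_sets_def by blast
qed

section \<open>Projective limits of finite measures\<close>

lemma distr_scale_measure:
  assumes "f \<in> M \<rightarrow>\<^sub>M N"
  shows "distr (scale_measure r M) N f = scale_measure r (distr M N f)"
proof (rule measure_eqI)
  fix A assume "A \<in> sets (distr (scale_measure r M) N f)"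
  moreover have "f \<in> scale_measure r M \<rightarrow>\<^sub>M N"
    using assms by simp
  ultimately show "emeasure (distr (scale_measure r M) N f) A = emeasure (scale_measure r (distr M N f)) A"
    using assms by (simp add: emeasure_distr space_scale_measure)
qed simp

text \<open>Restriction to the empty index set pushes every \<open>P J\<close> forward to
  \<open>P {}\<close> and preserves total mass. This yields one normalising constant for the whole
  family.\<close>

lemma projective_emeasure_space_eq:
  assumes "projective_finite_measures T M P" "finite J" "J \<subseteq> T"
  shows "emeasure (P J) (space (P J)) = emeasure (P {}) (space (P {}))"
proof -
  have *: "P {} = distr (P J) (PiM {} M) (\<lambda>x. restrict x {})" "sets (P J) = sets (PiM J M)"
    using assms by (auto simp: projective_finite_measures_def)
  have "(\<lambda>x. restrict x {}) \<in> P J \<rightarrow>\<^sub>M PiM {} M"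
    unfolding measurable_cong_sets[OF *(2) refl] by (rule measurable_restrict_subset) simp
  from emeasure_distr[OF this sets.top] show ?thesis
    unfolding *(1) space_distr using measurable_space[OF \<open>_ \<in> P J \<rightarrow>\<^sub>M _\<close>]
    by (metis Int_absorb1 subsetI vimageI)
qed

section \<open>Transport of projective families along codings\<close>

text \<open>For fixed \<open>x\<close>, the sets satisfying the equivalence form a \<sigma>-algebra
  containing the conditions on single coordinates.\<close>

lemma borel_coding_PiM:
  assumes coding: "\<And>t. t \<in> J \<Longrightarrow> borel_coding (M t) (g t) (h t)"
    and A: "A \<in> sets (PiM J M)" and x: "x \<in> space (PiM J M)"
  shows "(\<lambda>t\<in>J. h t (g t (x t))) \<in> A \<longleftrightarrow> x \<in> A"
proof -
  have hg: "h t (g t (x t)) \<in> B \<longleftrightarrow> x t \<in> B" if "t \<in> J" "B \<in> sets (M t)" for t B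
    using coding[OF that(1)] that x by (auto simp: borel_coding_def space_PiM PiE_iff)
  \<comment> \<open>The complement case requires both points to lie in the product space; for the
    recoded point this is \<open>hg\<close> with \<open>B = space (M t)\<close>.\<close>
  have sp: "(\<lambda>t\<in>J. h t (g t (x t))) \<in> (\<Pi>\<^sub>E t\<in>J. space (M t))" "x \<in> (\<Pi>\<^sub>E t\<in>J. space (M t))"
    using x hg[OF _ sets.top] by (auto simp: space_PiM PiE_iff)
  show ?thesis
    using A unfolding sets_PiM_single
  proof induction
    case (Basic B)
    then show ?case
      using sp hg by auto
  qed (use sp in auto)
qed

text \<open>Codings are assumed for nonempty factors only: an empty factor forces total mass 0, and
  then the null measure is a limit.\<close>

theorem ex_projective_limit:
  fixes P :: "'i set \<Rightarrow> ('i \<Rightarrow> 'a) measure"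
  assumes proj: "projective_finite_measures T M P"
    and coding: "\<And>t. t \<in> T \<Longrightarrow> space (M t) \<noteq> {} \<Longrightarrow> \<exists>g h. borel_coding (M t) g h"
  shows "\<exists>\<mu>. sets \<mu> = sets (PiM T M) \<and>
    (\<forall>J A. finite J \<and> J \<subseteq> T \<and> A \<in> sets (PiM J M) \<longrightarrow> emeasure \<mu> (prod_emb T M J A) = emeasure (P J) A)"
proof -
  define c where "c = emeasure (P {}) (space (P {}))"
  have sets_P: "sets (P J) = sets (PiM J M)" and fin_P: "finite_measure (P J)"
    if "finite J" "J \<subseteq> T" for J
    using proj that by (auto simp: projective_finite_measures_def)
  have restr_P: "P H = distr (P J) (PiM H M) (\<lambda>x. restrict x H)"
    if "finite J" "J \<subseteq> T" "H \<subseteq> J" for J H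
    using proj that unfolding projective_finite_measures_def by blast
  have mass: "emeasure (P J) (space (P J)) = c" if "finite J" "J \<subseteq> T" for J
    unfolding c_def by (rule projective_emeasure_space_eq[OF proj that])
  have c_fin: "c \<noteq> \<infinity>"
    using finite_measure.emeasure_finite[OF fin_P] by (auto simp: c_def)
  show ?thesis
  proof (cases "c = 0")
    case True
    have "emeasure (P J) A = 0" if "finite J" "J \<subseteq> T" "A \<in> sets (PiM J M)" for J A
      using emeasure_space[of "P J" A] mass[OF that(1,2)] True by simp
    then show ?thesis
      by (intro exI[of _ "null_measure (PiM T M)"]) auto
  next
    case False
    have c_inverse: "inverse c * c = 1"
      using False c_fin by (metis divide_ennreal_def ennreal_divide_self infinity_ennreal_def less_top mult.commute)
    have nonempty: "space (M t) \<noteq> {}" if "t \<in> T" for t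
    proof
      assume "space (M t) = {}"
      then have "space (P {t}) = {}"
        using sets_eq_imp_space_eq[OF sets_P[of "{t}"]] that by (simp add: space_PiM)
      with mass[of "{t}"] that False show False by simp
    qed
    obtain g h where gh: "\<And>t. t \<in> T \<Longrightarrow> borel_coding (M t) (g t) (h t)"
      using coding nonempty by metis
    define G where "G J x = (\<lambda>t\<in>J. g t (x t))" for J :: "'i set" and x
    define H where "H J y = (\<lambda>t\<in>J. h t (y t))" for J :: "'i set" and y
    let ?N = "\<lambda>J. PiM J (\<lambda>_ :: 'i. borel :: (nat \<Rightarrow> real) measure)"
    have G: "G J \<in> PiM J M \<rightarrow>\<^sub>M ?N J" if "J \<subseteq> T" for J
      unfolding G_def
    proof (rule measurable_restrict)
      fix t assume "t \<in> J"
      then show "(\<lambda>x. g t (x t)) \<in> PiM J M \<rightarrow>\<^sub>M borel"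
        using gh[of t] that by (intro measurable_compose[OF measurable_component_singleton]) (auto simp: borel_coding_def)
    qed
    have H: "H J \<in> ?N J \<rightarrow>\<^sub>M PiM J M" if "J \<subseteq> T" for J
      unfolding H_def
    proof (rule measurable_restrict)
      fix t assume "t \<in> J"
      then show "(\<lambda>y. h t (y t)) \<in> ?N J \<rightarrow>\<^sub>M M t"
        using gh[of t] that
        by (intro measurable_compose[OF measurable_component_singleton[where M = "\<lambda>_. borel"]])
          (auto simp: borel_coding_def)
    qed
    have GP: "G J \<in> P J \<rightarrow>\<^sub>M ?N J" if "finite J" "J \<subseteq> T" for J
      using G[OF that(2)] measurable_cong_sets[OF sets_P[OF that] refl] by blast

    \<comment> \<open>The locale \<open>polish_projective\<close> demands probability measures,
      hence the factor \<open>inverse c\<close>; in return it supplies \<open>Q.lim\<close>.\<close>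
    define Q where "Q J = scale_measure (inverse c) (distr (P J) (?N J) (G J))" for J
    interpret Q: polish_projective T Q
    proof (intro polish_projective.intro projective_family.intro)
      fix J K assume JK: "J \<subseteq> K" "finite K" "K \<subseteq> T"
      have r: "(\<lambda>x. restrict x J) \<in> P K \<rightarrow>\<^sub>M PiM J M"
        unfolding measurable_cong_sets[OF sets_P[OF JK(2,3)] refl]
        by (rule measurable_restrict_subset[OF JK(1)])
      have r': "(\<lambda>x. restrict x J) \<in> ?N K \<rightarrow>\<^sub>M ?N J"
        by (rule measurable_restrict_subset[OF JK(1)])
      have "distr (distr (P K) (?N K) (G K)) (?N J) (\<lambda>x. restrict x J)
          = distr (P K) (?N J) ((\<lambda>x. restrict x J) \<circ> G K)"
        using r' GP JK by (intro distr_distr) auto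
      \<comment> \<open>Coding acts coordinatewise and so commutes with restriction; this reduces
        projectivity of \<open>Q\<close> to that of \<open>P\<close>.\<close>
      also have "(\<lambda>x. restrict x J) \<circ> G K = G J \<circ> (\<lambda>x. restrict x J)"
        using JK(1) by (auto simp: G_def fun_eq_iff restrict_def)
      also have "distr (P K) (?N J) (G J \<circ> (\<lambda>x. restrict x J))
          = distr (distr (P K) (PiM J M) (\<lambda>x. restrict x J)) (?N J) (G J)"
        using r G JK by (intro distr_distr[symmetric]) auto
      also have "distr (P K) (PiM J M) (\<lambda>x. restrict x J) = P J"
        using restr_P[OF JK(2,3,1)] by simp
      finally have eq: "distr (distr (P K) (?N K) (G K)) (?N J) (\<lambda>x. restrict x J) = distr (P J) (?N J) (G J)" .
      have "(\<lambda>x. restrict x J) \<in> distr (P K) (?N K) (G K) \<rightarrow>\<^sub>M ?N J"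
        using r' by simp
      then show "Q J = distr (Q K) (?N J) (\<lambda>f. restrict f J)"
        unfolding Q_def by (simp only: distr_scale_measure eq)
    next
      fix J assume J: "finite J" "J \<subseteq> T"
      have "G J -` space (?N J) \<inter> space (P J) = space (P J)"
        using measurable_space[OF GP[OF J]] by blast
      then have "emeasure (distr (P J) (?N J) (G J)) (space (?N J)) = c"
        using mass[OF J] by (simp only: emeasure_distr[OF GP[OF J] sets.top])
      then show "prob_space (Q J)"
        using c_inverse by (intro prob_spaceI) (simp only: Q_def space_scale_measure space_distr emeasure_scale_measure)
    qed

    \<comment> \<open>The factor \<open>c\<close> undoes the normalisation in
      \<open>Q\<close>.\<close>
    define \<mu> where "\<mu> = scale_measure c (distr Q.lim (PiM T M) (H T))"
    have "emeasure \<mu> (prod_emb T M J A) = emeasure (P J) A"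
      if J: "finite J" "J \<subseteq> T" and A: "A \<in> sets (PiM J M)" for J A
    proof -
      let ?A = "H J -` A \<inter> space (?N J)"
      have HT: "H T \<in> Q.lim \<rightarrow>\<^sub>M PiM T M"
        using H[of T] measurable_cong_sets[OF Q.sets_lim refl] by blast
      have A': "?A \<in> sets (?N J)"
        using H[OF J(2)] A by (rule measurable_sets)
      \<comment> \<open>Decoding commutes with restriction too, so the preimage of a cylinder under
        \<open>H T\<close> is the cylinder over \<open>?A\<close>, where \<open>Q.lim\<close> agrees
        with \<open>Q J\<close>.\<close>
      have "restrict (H T y) J = H J (restrict y J)" for y
        using J(2) by (auto simp: H_def fun_eq_iff)
      then have "H T -` prod_emb T M J A \<inter> space Q.lim = prod_emb T (\<lambda>_. borel) J ?A"
        using measurable_space[OF H[of T]] by (auto simp: prod_emb_def space_PiM)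
      then have "emeasure (distr Q.lim (PiM T M) (H T)) (prod_emb T M J A) = emeasure (Q J) ?A"
        using J A A' HT by (simp add: emeasure_distr Q.emeasure_lim_emb)
      also have "\<dots> = inverse c * emeasure (P J) (G J -` ?A \<inter> space (P J))"
        unfolding Q_def emeasure_scale_measure by (subst emeasure_distr[OF GP[OF J] A']) simp
      \<comment> \<open>Coding followed by decoding preserves membership in \<open>A\<close>, so no
        part of \<open>A\<close> is lost or gained.\<close>
      also have "G J -` ?A \<inter> space (P J) = A"
      proof -
        have "H J (G J x) \<in> A \<longleftrightarrow> x \<in> A" if "x \<in> space (PiM J M)" for x
          using borel_coding_PiM[OF gh A that] J(2) by (auto simp: G_def H_def cong: restrict_cong)
        then show ?thesis
          using sets.sets_into_space[OF A] sets_eq_imp_space_eq[OF sets_P[OF J]]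
            measurable_space[OF G[OF J(2)]] by auto
      qed
      finally show ?thesis
        using c_inverse by (simp add: \<mu>_def mult.commute[of c] flip: mult.assoc)
    qed
    then show ?thesis
      by (intro exI[of _ \<mu>]) (auto simp: \<mu>_def)
  qed
qed

section \<open>Consistency on cylinder sets, existence and uniqueness of the extension\<close>

theorem theorem4p13:
  fixes T :: "'i set"
    and E :: "'i \<Rightarrow> 'a set"
    and d :: "'i \<Rightarrow> 'a \<Rightarrow> 'a \<Rightarrow> ennreal"
    and F :: "'i \<Rightarrow> 'a measure"
    and P :: "'i set \<Rightarrow> ('i \<Rightarrow> 'a) measure"
  assumes "\<And>t. t \<in> T \<Longrightarrow> ext_pseudo_metric (E t) (d t)"
    and "\<And>t. t \<in> T \<Longrightarrow> second_countable (epm_topology (E t) (d t))"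
    and "\<And>t. t \<in> T \<Longrightarrow> epm_complete (E t) (d t)"
    and "\<And>t. t \<in> T \<Longrightarrow> F t = epm_borel (E t) (d t)"
    and "projective_finite_measures T F P"
  shows "(\<forall>J A. finite J \<and> J \<subseteq> T \<and> A \<in> sets (PiM J F) \<longrightarrow>
              cylinder_function T F P (prod_emb T F J A) = emeasure (P J) A) \<and>
         (\<exists>!\<mu>. space \<mu> = (\<Pi>\<^sub>E t\<in>T. E t) \<and>
               sets \<mu> = sigma_sets (\<Pi>\<^sub>E t\<in>T. E t) (cylinder_sets T F) \<and>
               (\<forall>C\<in>cylinder_sets T F. emeasure \<mu> C = cylinder_function T F P C))"
proof -
  have "\<exists>g h. borel_coding (F t) g h" if "t \<in> T" "space (F t) \<noteq> {}" for t
    using ex_borel_coding[OF assms(1-3)] assms(4) that by simp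
  then obtain \<mu> where sets_\<mu>: "sets \<mu> = sets (PiM T F)"
    and \<mu>: "\<And>J A. finite J \<Longrightarrow> J \<subseteq> T \<Longrightarrow> A \<in> sets (PiM J F) \<Longrightarrow> emeasure \<mu> (prod_emb T F J A) = emeasure (P J) A"
    using ex_projective_limit[OF assms(5)] by metis
  \<comment> \<open>Consistency is read off from the limit \<mu>: the values of two representations
    of a cylinder set both equal its measure under \<mu>. A direct comparison would have to handle
    projections that are not onto, as happens with an empty factor.\<close>
  have cyl: "cylinder_function T F P (prod_emb T F J A) = emeasure (P J) A"
    if "finite J" "J \<subseteq> T" "A \<in> sets (PiM J F)" for J A
    unfolding cylinder_function_def
  proof (rule the_equality)
    show "\<exists>K B. finite K \<and> K \<subseteq> T \<and> B \<in> sets (PiM K F) \<and>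
        prod_emb T F J A = prod_emb T F K B \<and> emeasure (P J) A = emeasure (P K) B"
      using that by blast
  next
    fix c assume "\<exists>K B. finite K \<and> K \<subseteq> T \<and> B \<in> sets (PiM K F) \<and>
        prod_emb T F J A = prod_emb T F K B \<and> c = emeasure (P K) B"
    then obtain K B where K: "finite K" "K \<subseteq> T" "B \<in> sets (PiM K F)"
      and eq: "prod_emb T F J A = prod_emb T F K B" and c: "c = emeasure (P K) B"
      by blast
    show "c = emeasure (P J) A"
      using \<mu>[OF K] \<mu>[OF that] by (simp only: c eq)
  qed
  have cyl_\<mu>: "emeasure \<mu> C = cylinder_function T F P C \<and> emeasure \<mu> C \<noteq> \<infinity>"
    if C: "C \<in> cylinder_sets T F" for C
  proof -
    obtain J A where J: "finite J" "J \<subseteq> T" "A \<in> sets (PiM J F)" and C: "C = prod_emb T F J A"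
      using C unfolding cylinder_sets_def by blast
    have "finite_measure (P J)"
      using assms(5) J unfolding projective_finite_measures_def by blast
    then show ?thesis
      unfolding C cyl[OF J] \<mu>[OF J] by (simp add: finite_measure.emeasure_finite)
  qed
  have space_T: "space (PiM T F) = (\<Pi>\<^sub>E t\<in>T. E t)"
    using assms(4) by (simp add: space_PiM cong: PiE_cong)
  let ?limit = "\<lambda>\<nu>. space \<nu> = (\<Pi>\<^sub>E t\<in>T. E t) \<and>
    sets \<nu> = sigma_sets (\<Pi>\<^sub>E t\<in>T. E t) (cylinder_sets T F) \<and>
    (\<forall>C\<in>cylinder_sets T F. emeasure \<nu> C = cylinder_function T F P C)"
  have lim_\<mu>: "?limit \<mu>"
    using sets_eq_imp_space_eq[OF sets_\<mu>] cyl_\<mu> sets_\<mu>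
    unfolding sets_PiM_cylinder_sets[of T F] space_T by blast
  have "\<nu> = \<mu>" if lim_\<nu>: "?limit \<nu>" for \<nu>
  proof (rule measure_eqI_generator_eq[OF Int_stable_cylinder_sets])
    show "cylinder_sets T F \<subseteq> Pow (\<Pi>\<^sub>E t\<in>T. E t)"
      using cylinder_sets_subset unfolding space_T[symmetric] .
    \<comment> \<open>A constant sequence exhausts the space, since the whole space is a cylinder
      set of finite measure.\<close>
    show "range (\<lambda>_::nat. \<Pi>\<^sub>E t\<in>T. E t) \<subseteq> cylinder_sets T F"
      using space_PiM_in_cylinder_sets[of T F] unfolding space_T by blast
    show "emeasure \<nu> (\<Pi>\<^sub>E t\<in>T. E t) \<noteq> \<infinity>"
      using lim_\<nu> cyl_\<mu> space_PiM_in_cylinder_sets[of T F] unfolding space_T by metis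
  qed (use lim_\<mu> lim_\<nu> in simp_all)
  with lim_\<mu> have "\<exists>!\<nu>. ?limit \<nu>"
    by (rule ex1I)
  moreover have "\<forall>J A. finite J \<and> J \<subseteq> T \<and> A \<in> sets (PiM J F) \<longrightarrow>
      cylinder_function T F P (prod_emb T F J A) = emeasure (P J) A"
    using cyl by blast
  ultimately show ?thesis
    by (rule conjI[rotated])
qed

end
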